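(* There is a unique homomorphism $\lambda:\mathbf{SB}(S_n)\to\mathbf{F}^*_n$ such that $$\lambda(\sigma_{s_i})=s_i\quad\text{and}\quad\lambda(\tau_{s_i})=\xi_i,\qquad\text{for } i=1,2,\dots,n-1.$$ This homomorphism is surjective.
   Context: The singular Artin monoid $\mathbf{SB}(S_n)$ of type $A_{n-1}$ (the singular braid monoid on $n$ strands) is the monoid generated by invertible elements $\sigma_i=\sigma_{s_i}$ and elements $\tau_i=\tau_{s_i}$, $1\le i\le n-1$, subject to: $\sigma_i\sigma_j\sigma_i=\sigma_j\sigma_i\sigma_j$ and $\tau_i\sigma_j\sigma_i=\sigma_j\sigma_i\tau_j$ for $|i-j|=1$; $\sigma_i\sigma_j=\sigma_j\sigma_i$, $\tau_i\sigma_j=\sigma_j\tau_i$ and $\tau_i\tau_j=\tau_j\tau_i$ for $|i-j|>1$; and $\tau_i\sigma_i=\sigma_i\tau_i$ for all $i$. Let $\underline{n}=\{1,\dots,n\}$. $\mathbf{I}^*_n$ is the dual symmetric inverse monoid: the set of all bijections from the set of blocks of a set partition of $\underline n$ to the set of blocks of another set partition of $\underline{n}$. The product $\alpha\beta$ (first $\beta:P\to Q$, then $\alpha:R\to T$, where $P,Q,R,T$ are partitions) is obtained by taking the join $J$ of $Q$ and $R$ (finest partition coarser than both) and sending, for each block $X$ of $J$, the union of the blocks $\beta^{-1}(Y)$, $Y\in Q$, $Y\subset X$, to the union of the blocks $\alpha(Z)$, $Z\in R$, $Z\subset X$. $\mathbf{F}^*_n$ is the submonoid of $\mathbf{I}^*_n$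 consisting of those bijections which send each block to a block of the same cardinality (the maximal factorizable submonoid). Its group of units is $S_n$ (bijections between partitions into singletons), and $s_i$ is the transposition $(i,i+1)$. $\xi_i$ is the idempotent given by the identity map on the partition of $\underline n$ whose only non-singleton block is $\{i,i+1\}$. *)

theory Defs
  imports
    "HOL-Algebra.Group"
    "HOL-Library.Disjoint_Sets"
    "HOL-Combinatorics.Transposition"
begin

section \<open>Monoid homomorphisms and monoid presentations\<close>

text \<open>The library's \<^const>\<open>hom\<close> does not require the unit to be preserved.\<close>

definition monoid_hom ::
    "('a, 'c) monoid_scheme \<Rightarrow> ('b, 'd) monoid_scheme \<Rightarrow> ('a \<Rightarrow> 'b) set" where
  "monoid_hom G H = {h \<in> hom G H. h \<one>\<^bsub>G\<^esub> = \<one>\<^bsub>H\<^esub>}"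

inductive_set presentation_cong :: "'a set \<Rightarrow> ('a list \<times> 'a list) set \<Rightarrow> ('a list \<times> 'a list) set"
  for A :: "'a set" and R :: "('a list \<times> 'a list) set" where
  rel: "(p @ u @ q, p @ v @ q) \<in> presentation_cong A R"
    if "(u, v) \<in> R" "u \<in> lists A" "v \<in> lists A" "p \<in> lists A" "q \<in> lists A"
| refl: "(u, u) \<in> presentation_cong A R" if "u \<in> lists A"
| sym: "(v, u) \<in> presentation_cong A R" if "(u, v) \<in> presentation_cong A R"
| trans: "(u, w) \<in> presentation_cong A R"
    if "(u, v) \<in> presentation_cong A R" "(v, w) \<in> presentation_cong A R"

text \<open>The monoid with generators \<open>A\<close> and relations \<open>u = v\<close> for \<open>(u, v) \<in> R\<close>: the free monoid
  of words over \<open>A\<close> modulo the congruence generated by \<open>R\<close>.\<close>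

definition presented_monoid :: "'a set \<Rightarrow> ('a list \<times> 'a list) set \<Rightarrow> 'a list set monoid" where
  "presented_monoid A R =
    \<lparr>carrier = lists A // presentation_cong A R,
     mult = (\<lambda>X Y. \<Union>u\<in>X. \<Union>v\<in>Y. presentation_cong A R `` {u @ v}),
     one = presentation_cong A R `` {[]}\<rparr>"


section \<open>The singular Artin monoid of type \<open>A\<^bsub>n-1\<^esub>\<close>\<close>

datatype sb_gen = Sigma nat | Sigma_inv nat | Tau nat

definition sb_gens :: "nat \<Rightarrow> sb_gen set" where
  "sb_gens n = Sigma ` {1..<n} \<union> Sigma_inv ` {1..<n} \<union> Tau ` {1..<n}"

inductive_set sb_rels :: "nat \<Rightarrow> (sb_gen list \<times> sb_gen list) set" for n :: nat where
  inv_right: "([Sigma i, Sigma_inv i], []) \<in> sb_rels n"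
    if "i \<in> {1..<n}"
| inv_left: "([Sigma_inv i, Sigma i], []) \<in> sb_rels n"
    if "i \<in> {1..<n}"
| braid: "([Sigma i, Sigma j, Sigma i], [Sigma j, Sigma i, Sigma j]) \<in> sb_rels n"
    if "i \<in> {1..<n}" "j \<in> {1..<n}" "\<bar>int i - int j\<bar> = 1"
| tau_braid: "([Tau i, Sigma j, Sigma i], [Sigma j, Sigma i, Tau j]) \<in> sb_rels n"
    if "i \<in> {1..<n}" "j \<in> {1..<n}" "\<bar>int i - int j\<bar> = 1"
| sigma_comm: "([Sigma i, Sigma j], [Sigma j, Sigma i]) \<in> sb_rels n"
    if "i \<in> {1..<n}" "j \<in> {1..<n}" "\<bar>int i - int j\<bar> > 1"
| tau_sigma_comm: "([Tau i, Sigma j], [Sigma j, Tau i]) \<in> sb_rels n"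
    if "i \<in> {1..<n}" "j \<in> {1..<n}" "\<bar>int i - int j\<bar> > 1"
| tau_comm: "([Tau i, Tau j], [Tau j, Tau i]) \<in> sb_rels n"
    if "i \<in> {1..<n}" "j \<in> {1..<n}" "\<bar>int i - int j\<bar> > 1"
| tau_sigma_same: "([Tau i, Sigma i], [Sigma i, Tau i]) \<in> sb_rels n"
    if "i \<in> {1..<n}"

definition SB :: "nat \<Rightarrow> sb_gen list set monoid" where
  "SB n = presented_monoid (sb_gens n) (sb_rels n)"

definition sb_sigma :: "nat \<Rightarrow> nat \<Rightarrow> sb_gen list set" where
  "sb_sigma n i = presentation_cong (sb_gens n) (sb_rels n) `` {[Sigma i]}"

definition sb_tau :: "nat \<Rightarrow> nat \<Rightarrow> sb_gen list set" where
  "sb_tau n i = presentation_cong (sb_gens n) (sb_rels n) `` {[Tau i]}"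


section \<open>The dual symmetric inverse monoid and its maximal factorizable submonoid\<close>

text \<open>\<^term>\<open>refines A P Q\<close> says that \<open>P\<close> and \<open>Q\<close> are partitions of \<open>A\<close> with \<open>Q\<close> coarser
  than \<open>P\<close>.\<close>

definition partition_join :: "'a set \<Rightarrow> 'a set set \<Rightarrow> 'a set set \<Rightarrow> 'a set set" where
  "partition_join A P Q =
    (THE J. refines A P J \<and> refines A Q J \<and>
      (\<forall>K. refines A P K \<and> refines A Q K \<longrightarrow> refines A J K))"

text \<open>A bijection \<open>f\<close> from the set \<open>P\<close> of blocks to the set \<open>Q\<close> of blocks is represented by its
  graph, a set of pairs of blocks. Thus \<open>P\<close> and \<open>Q\<close> are its \<^const>\<open>Domain\<close> and \<^const>\<open>Range\<close>.\<close>

definition block_bijections :: "nat \<Rightarrow> (nat set \<times> nat set) set set" where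
  "block_bijections n =
    {{(X, f X) | X. X \<in> P} | P Q f.
      partition_on {1..n} P \<and> partition_on {1..n} Q \<and> bij_betw f P Q}"

text \<open>In a product the right-hand factor is applied first.\<close>

definition block_mult ::
    "nat \<Rightarrow> (nat set \<times> nat set) set \<Rightarrow> (nat set \<times> nat set) set \<Rightarrow> (nat set \<times> nat set) set" where
  "block_mult n \<alpha> \<beta> =
    {(\<Union>{B. \<exists>Y. (B, Y) \<in> \<beta> \<and> Y \<subseteq> X}, \<Union>{C. \<exists>Z. (Z, C) \<in> \<alpha> \<and> Z \<subseteq> X}) | X.
      X \<in> partition_join {1..n} (Range \<beta>) (Domain \<alpha>)}"

definition perm_element :: "nat \<Rightarrow> (nat \<Rightarrow> nat) \<Rightarrow> (nat set \<times> nat set) set" where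
  "perm_element n \<pi> = {({x}, {\<pi> x}) | x. x \<in> {1..n}}"

definition dual_sym_inv_monoid :: "nat \<Rightarrow> (nat set \<times> nat set) set monoid" where
  "dual_sym_inv_monoid n =
    \<lparr>carrier = block_bijections n, mult = block_mult n, one = perm_element n id\<rparr>"

definition factorizable_dual_monoid :: "nat \<Rightarrow> (nat set \<times> nat set) set monoid" where
  "factorizable_dual_monoid n =
    (dual_sym_inv_monoid n)
      \<lparr>carrier := {\<alpha> \<in> carrier (dual_sym_inv_monoid n). \<forall>(X, Y) \<in> \<alpha>. card X = card Y}\<rparr>"

definition simple_transposition :: "nat \<Rightarrow> nat \<Rightarrow> (nat set \<times> nat set) set" where
  "simple_transposition n i = perm_element n (transpose i (i + 1))"

definition xi :: "nat \<Rightarrow> nat \<Rightarrow> (nat set \<times> nat set) set" where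
  "xi n i = Id_on (insert {i, i + 1} {{x} | x. x \<in> {1..n} - {i, i + 1}})"

end

theory Submission
  imports Defs "HOL-Combinatorics.Permutations"
begin

text \<open>
  Every element of the maximal factorizable submonoid is induced by a permutation \<open>\<pi>\<close> and a set
  \<open>E\<close> of subsets (edges) of \<open>{1..n}\<close>: the edges are glued, and each block \<open>X\<close> of the partition that
  results is sent to \<open>\<pi> ` X\<close>. In these terms the product, whose definition involves a join of
  partitions, becomes that of a semidirect product (\<open>block_mult_glued_perm\<close>):
  \<open>(\<pi>, E) (\<rho>, F) = (\<pi> \<circ> \<rho>, F \<union> \<rho>\<^sup>-\<^sup>1 E)\<close>. Joins have turned into unions, and associativity
  of the product is that of composition and union.

  A word in the generators evaluates to such a pair: \<open>Sigma i\<close> and its inverse contribute the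
  transposition of \<open>i\<close> and \<open>i + 1\<close>, and \<open>Tau i\<close> contributes the edge \<open>{i, i + 1}\<close>, pulled back along
  the permutation of the letters to its right. The defining relations preserve the permutation
  and the edge set on the nose (\<open>word_perm_edges_sb_rels\<close>), so evaluation descends to
  the singular braid monoid. This gives existence.

  Surjectivity (\<open>word_value_surj\<close>) holds because adjacent transpositions generate all
  permutations, and conjugating a \<open>Tau\<close> by a permutation produces any edge with two points; every
  partition is generated by the pairs of points that share a block. For uniqueness (\<open>hom_eq_word_value\<close>),
  the prescribed values leave only \<open>Sigma_inv i\<close> open, and its value is a left
  inverse of the involution \<open>s\<^sub>i\<close>, hence equal to \<open>s\<^sub>i\<close>.
\<close>

section \<open>Partitions generated by gluing\<close>

definition glue_rel :: "'a set \<Rightarrow> 'a set set \<Rightarrow> 'a rel" where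
  "glue_rel A E = Restr ((\<Union>e\<in>E. e \<times> e)\<^sup>*) A"

definition blocks :: "'a set \<Rightarrow> 'a set set \<Rightarrow> 'a set set" where
  "blocks A E = A // glue_rel A E"

lemma equiv_glue_rel: "equiv A (glue_rel A E)"
proof (rule equivI)
  have "sym ((\<Union>e\<in>E. e \<times> e)\<^sup>*)"
    by (intro sym_rtrancl) (auto simp: sym_def)
  then show "sym (glue_rel A E)"
    by (auto simp: glue_rel_def sym_def)
  show "trans (glue_rel A E)"
    by (auto simp: glue_rel_def trans_def intro: rtrancl_trans)
qed (auto simp: glue_rel_def refl_on_def)

lemma partition_on_blocks: "partition_on A (blocks A E)"
  unfolding blocks_def by (intro partition_on_quotient equiv_glue_rel)

lemma edge_in_block:
  assumes "e \<in> E" "e \<subseteq> A" "X \<in> blocks A E" "e \<inter> X \<noteq> {}"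
  shows "e \<subseteq> X"
  using assms unfolding blocks_def glue_rel_def
  by (auto elim!: quotientE intro: rtrancl_into_rtrancl)

text \<open>The partition generated by \<open>E\<close> is the finest one that cuts no edge of \<open>E\<close>: a path of edges
  cannot leave a block that contains, with any point of an edge, the whole edge. In this form the
  universal property of a join can be read off from the edges alone.\<close>

lemma refines_blocks_iff:
  assumes "E \<subseteq> Pow A"
  shows "refines A (blocks A E) K \<longleftrightarrow>
    partition_on A K \<and> (\<forall>e\<in>E. \<forall>Y\<in>K. e \<inter> Y \<noteq> {} \<longrightarrow> e \<subseteq> Y)"
    (is "?ref \<longleftrightarrow> ?part \<and> ?resp")
proof (intro iffI conjI ballI impI subsetI)
  assume ref: ?ref
  then show K: ?part
    by (simp add: refines_def)
  fix e Y x
  assume "e \<in> E" "Y \<in> K" "e \<inter> Y \<noteq> {}" "x \<in> e"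
  then obtain y where *: "e \<in> E" "Y \<in> K" "x \<in> e" "y \<in> e" "y \<in> Y"
    by blast
  then have "y \<in> A" "e \<subseteq> A"
    using assms by auto
  then obtain X where X: "X \<in> blocks A E" "y \<in> X"
    using partition_on_blocks[of A E] by (auto simp: partition_on_def)
  then have "e \<subseteq> X"
    using * \<open>e \<subseteq> A\<close> by (intro edge_in_block[of e E A X]) auto
  moreover obtain Z where Z: "Z \<in> K" "X \<subseteq> Z"
    using ref X(1) by (auto simp: refines_def)
  moreover have "Z = Y"
    using K Z X(2) * by (auto simp: partition_on_def disjoint_def)
  ultimately show "x \<in> Y"
    using * by auto
next
  assume "?part \<and> ?resp"
  then have K: ?part and resp: ?resp
    by blast+
  have "\<exists>Y\<in>K. X \<subseteq> Y" if X: "X \<in> blocks A E" for X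
  proof -
    obtain x where x: "x \<in> A" "X = glue_rel A E `` {x}"
      using X unfolding blocks_def by (auto elim: quotientE)
    then obtain Y where Y: "Y \<in> K" "x \<in> Y"
      using K by (auto simp: partition_on_def)
    have "y \<in> Y" if "(x, y) \<in> (\<Union>e\<in>E. e \<times> e)\<^sup>*" for y
      using that by induction (use Y resp in auto)
    then show ?thesis
      using Y x by (auto simp: glue_rel_def)
  qed
  then show ?ref
    using K partition_on_blocks by (auto simp: refines_def)
qed

lemma partition_join_eqI:
  assumes "refines A P J" "refines A Q J"
    and "\<And>K. refines A P K \<Longrightarrow> refines A Q K \<Longrightarrow> refines A J K"
  shows "partition_join A P Q = J"
  unfolding partition_join_def by (rule the_equality) (use assms refines_asym in blast)+

lemma refines_blocks_Un_iff:
  assumes "E \<subseteq> Pow A" "F \<subseteq> Pow A"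
  shows "refines A (blocks A (E \<union> F)) K \<longleftrightarrow>
    refines A (blocks A E) K \<and> refines A (blocks A F) K"
  using assms by (simp add: refines_blocks_iff ball_Un) blast

lemma refines_blocks_Un:
  assumes "E \<subseteq> Pow A" "F \<subseteq> Pow A"
  shows "refines A (blocks A E) (blocks A (E \<union> F))" "refines A (blocks A F) (blocks A (E \<union> F))"
  using refines_blocks_Un_iff[OF assms] refines_refl[OF partition_on_blocks] by blast+

text \<open>Not cutting the edges of \<open>E \<union> F\<close> means not cutting those of \<open>E\<close> nor those of \<open>F\<close>.\<close>

lemma partition_join_blocks:
  assumes "E \<subseteq> Pow A" "F \<subseteq> Pow A"
  shows "partition_join A (blocks A E) (blocks A F) = blocks A (E \<union> F)"
  using refines_blocks_Un[OF assms] refines_blocks_Un_iff[OF assms]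
  by (intro partition_join_eqI) auto

lemma glue_rel_image:
  assumes "\<rho> permutes A"
  shows "(\<rho> x, \<rho> y) \<in> glue_rel A ((`) \<rho> ` E) \<longleftrightarrow> (x, y) \<in> glue_rel A E"
proof -
  have push: "(\<pi> x, \<pi> y) \<in> (\<Union>e\<in>(`) \<pi> ` E. e \<times> e)\<^sup>*"
    if "(x, y) \<in> (\<Union>e\<in>E. e \<times> e)\<^sup>*" for \<pi> :: "'a \<Rightarrow> 'a" and x y E
    using that by induction (auto intro: rtrancl_into_rtrancl)
  have "(`) (inv_into UNIV \<rho>) ` (`) \<rho> ` E = E"
    using assms by (simp add: image_image permutes_inverses)
  then have "(x, y) \<in> (\<Union>e\<in>E. e \<times> e)\<^sup>*" if "(\<rho> x, \<rho> y) \<in> (\<Union>e\<in>(`) \<rho> ` E. e \<times> e)\<^sup>*"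
    using push[OF that, of "inv_into UNIV \<rho>"] assms by (simp add: permutes_inverses)
  then show ?thesis
    using push[of x y E \<rho>] assms by (auto simp: glue_rel_def permutes_in_image)
qed

lemma blocks_image:
  assumes "\<rho> permutes A"
  shows "blocks A ((`) \<rho> ` E) = (`) \<rho> ` blocks A E"
proof -
  have "glue_rel A ((`) \<rho> ` E) `` {\<rho> x} = \<rho> ` (glue_rel A E `` {x})" for x
  proof (intro Set.set_eqI)
    fix y
    obtain z where "y = \<rho> z"
      using permutes_surj[OF assms] by (metis surjD)
    then show "y \<in> glue_rel A ((`) \<rho> ` E) `` {\<rho> x} \<longleftrightarrow> y \<in> \<rho> ` (glue_rel A E `` {x})"
      using permutes_inj[OF assms] by (auto simp: glue_rel_image[OF assms] inj_def)
  qed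
  then have "(\<lambda>x. {glue_rel A ((`) \<rho> ` E) `` {x}}) (\<rho> x) = {\<rho> ` (glue_rel A E `` {x})}" for x
    by simp
  then have "(\<Union>x\<in>\<rho> ` A. {glue_rel A ((`) \<rho> ` E) `` {x}}) = (`) \<rho> ` (\<Union>x\<in>A. {glue_rel A E `` {x}})"
    by auto
  then show ?thesis
    unfolding blocks_def quotient_def permutes_image[OF assms] .
qed

text \<open>Two-element edges suffice to generate a given partition; these are the edges that a conjugate of
  a single \<open>Tau\<close> can realise.\<close>

lemma blocks_partition:
  assumes "partition_on A P"
  shows "blocks A {{x, y} | x y. x \<noteq> y \<and> (\<exists>X\<in>P. x \<in> X \<and> y \<in> X)} = P"
proof -
  let ?E = "{{x, y} | x y. x \<noteq> y \<and> (\<exists>X\<in>P. x \<in> X \<and> y \<in> X)}"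
  let ?r = "{(x, y). \<exists>X\<in>P. x \<in> X \<and> y \<in> X}"
  have eq: "equiv A ?r"
    using assms by (rule equiv_partition_on)
  have glued: "(x, y) \<in> ?r" if "(x, y) \<in> (\<Union>e\<in>?E. e \<times> e)\<^sup>*" "x \<in> A" for x y
    using that
  proof induction
    case base
    then show ?case using eq by (meson equivE refl_onD)
  next
    case (step y z)
    then have "(y, z) \<in> ?r" by auto
    with step show ?case using eq by (meson equivE transD)
  qed
  have edge: "(x, y) \<in> (\<Union>e\<in>?E. e \<times> e)\<^sup>*" if "(x, y) \<in> ?r" for x y
    using that by (cases "x = y") (auto intro!: r_into_rtrancl)
  have "glue_rel A ?E = ?r"
  proof (intro equalityI subrelI)
    fix x y assume "(x, y) \<in> glue_rel A ?E"
    then show "(x, y) \<in> ?r"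
      by (intro glued) (simp_all add: glue_rel_def)
  next
    fix x y assume xy: "(x, y) \<in> ?r"
    then have "(x, y) \<in> A \<times> A"
      using equiv_type[OF eq] by blast
    then show "(x, y) \<in> glue_rel A ?E"
      using edge[OF xy] by (simp add: glue_rel_def)
  qed
  then show ?thesis
    unfolding blocks_def using partition_on_eq_quotient[OF assms] by simp
qed


section \<open>Permutations with gluing\<close>

definition glued_perm :: "'a set \<Rightarrow> ('a \<Rightarrow> 'a) \<Rightarrow> 'a set set \<Rightarrow> ('a set \<times> 'a set) set" where
  "glued_perm A \<pi> E = {(X, \<pi> ` X) | X. X \<in> blocks A E}"

text \<open>The middle partition of the product is the join of \<open>\<rho> (blocks A F)\<close> and \<open>blocks A E\<close>, generated by
  \<open>\<rho> F \<union> E = \<rho> (F \<union> \<rho>\<^sup>-\<^sup>1 E)\<close>. Its blocks therefore are the images \<open>\<rho> ` W\<close> of the blocks \<open>W\<close> generated by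
  \<open>F \<union> \<rho>\<^sup>-\<^sup>1 E\<close>. Collecting the blocks on either side of \<open>\<rho> ` W\<close> gives \<open>W\<close> and \<open>\<pi> ` \<rho> ` W\<close>, because a
  block is the union of the blocks of any finer partition that lie inside it.\<close>

lemma block_mult_glued_perm:
  fixes n :: nat
  defines "A \<equiv> {1..n}"
  assumes \<rho>: "\<rho> permutes A" and E: "E \<subseteq> Pow A" and F: "F \<subseteq> Pow A"
  shows "block_mult n (glued_perm A \<pi> E) (glued_perm A \<rho> F) =
    glued_perm A (\<pi> \<circ> \<rho>) (F \<union> (-`) \<rho> ` E)"
proof -
  define G where "G = F \<union> (-`) \<rho> ` E"
  have pre: "(-`) \<rho> ` E \<subseteq> Pow A" and img: "(`) \<rho> ` F \<subseteq> Pow A"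
    using E F permutes_vimage[OF \<rho>] permutes_image[OF \<rho>] by blast+
  have G: "(`) \<rho> ` F \<union> E = (`) \<rho> ` G"
    using permutes_surj[OF \<rho>] by (simp add: G_def image_Un image_image)
  have "Range (glued_perm A \<rho> F) = blocks A ((`) \<rho> ` F)" "Domain (glued_perm A \<pi> E) = blocks A E"
    by (auto simp: glued_perm_def blocks_image[OF \<rho>])
  then have join: "partition_join {1..n} (Range (glued_perm A \<rho> F)) (Domain (glued_perm A \<pi> E))
      = (`) \<rho> ` blocks A G"
    using partition_join_blocks[OF img E] by (simp only: G blocks_image[OF \<rho>] flip: A_def)
  \<comment> \<open>The two components of the pair that the product assigns to the middle block \<open>\<rho> ` W\<close>.\<close>
  have src: "\<Union>{B. \<exists>Y. (B, Y) \<in> glued_perm A \<rho> F \<and> Y \<subseteq> \<rho> ` W} = W" if "W \<in> blocks A G" for W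
  proof -
    have "{B. \<exists>Y. (B, Y) \<in> glued_perm A \<rho> F \<and> Y \<subseteq> \<rho> ` W} = {B \<in> blocks A F. B \<subseteq> W}"
      by (auto simp: glued_perm_def inj_image_subset_iff[OF permutes_inj[OF \<rho>]])
    moreover have "partition_on W {B \<in> blocks A F. B \<subseteq> W}"
      using refines_blocks_Un(1)[OF F pre] that by (intro refines_obtains_subset) (auto simp: G_def)
    ultimately show ?thesis
      by (simp add: partition_on_def)
  qed
  have tgt: "\<Union>{C. \<exists>Z. (Z, C) \<in> glued_perm A \<pi> E \<and> Z \<subseteq> \<rho> ` W} = (\<pi> \<circ> \<rho>) ` W"
    if "W \<in> blocks A G" for W
  proof -
    have "{C. \<exists>Z. (Z, C) \<in> glued_perm A \<pi> E \<and> Z \<subseteq> \<rho> ` W} = (`) \<pi> ` {Z \<in> blocks A E. Z \<subseteq> \<rho> ` W}"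
      by (auto simp: glued_perm_def)
    moreover have "partition_on (\<rho> ` W) {Z \<in> blocks A E. Z \<subseteq> \<rho> ` W}"
      using refines_blocks_Un(2)[OF img E] that
      by (intro refines_obtains_subset) (auto simp: G blocks_image[OF \<rho>])
    ultimately show ?thesis
      by (simp add: partition_on_def image_comp flip: image_Union)
  qed
  have "block_mult n (glued_perm A \<pi> E) (glued_perm A \<rho> F) = {(W, (\<pi> \<circ> \<rho>) ` W) | W. W \<in> blocks A G}"
    unfolding block_mult_def join
  proof (intro Set.set_eqI iffI)
    fix p
    assume "p \<in> {(\<Union>{B. \<exists>Y. (B, Y) \<in> glued_perm A \<rho> F \<and> Y \<subseteq> X},
      \<Union>{C. \<exists>Z. (Z, C) \<in> glued_perm A \<pi> E \<and> Z \<subseteq> X}) | X. X \<in> (`) \<rho> ` blocks A G}"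
    then show "p \<in> {(W, (\<pi> \<circ> \<rho>) ` W) | W. W \<in> blocks A G}"
      using src tgt by auto
  next
    fix p
    assume "p \<in> {(W, (\<pi> \<circ> \<rho>) ` W) | W. W \<in> blocks A G}"
    then obtain W where W: "W \<in> blocks A G" "p = (W, (\<pi> \<circ> \<rho>) ` W)"
      by auto
    show "p \<in> {(\<Union>{B. \<exists>Y. (B, Y) \<in> glued_perm A \<rho> F \<and> Y \<subseteq> X},
      \<Union>{C. \<exists>Z. (Z, C) \<in> glued_perm A \<pi> E \<and> Z \<subseteq> X}) | X. X \<in> (`) \<rho> ` blocks A G}"
      using W src[OF W(1)] tgt[OF W(1)] by (intro CollectI exI[of _ "\<rho> ` W"]) auto
  qed
  then show ?thesis
    by (simp add: glued_perm_def G_def)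
qed

lemma glued_perm_in_factorizable:
  assumes \<pi>: "\<pi> permutes {1..n}"
  shows "glued_perm {1..n} \<pi> E \<in> carrier (factorizable_dual_monoid n)"
proof -
  let ?P = "blocks {1..n} E"
  have "inj_on ((`) \<pi>) ?P"
    using permutes_inj[OF \<pi>] by (intro inj_onI) (simp add: inj_image_eq_iff)
  then have "bij_betw ((`) \<pi>) ?P (blocks {1..n} ((`) \<pi> ` E))"
    unfolding bij_betw_def blocks_image[OF \<pi>] by simp
  then have "glued_perm {1..n} \<pi> E \<in> block_bijections n"
    unfolding block_bijections_def glued_perm_def
    using partition_on_blocks by blast
  moreover have "\<forall>(X, Y) \<in> glued_perm {1..n} \<pi> E. card X = card Y"
    using permutes_inj[OF \<pi>] by (auto simp: glued_perm_def card_image inj_on_subset)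
  ultimately show ?thesis
    by (simp add: factorizable_dual_monoid_def dual_sym_inv_monoid_def)
qed

text \<open>Each block has the same size as its image, so the bijection of blocks is induced by bijections
  between the points of corresponding blocks. These fit together to a permutation, as the
  blocks on either side partition \<open>{1..n}\<close>.\<close>

lemma factorizable_eq_glued_perm:
  assumes "\<alpha> \<in> carrier (factorizable_dual_monoid n)"
  obtains \<pi> E where "\<pi> permutes {1..n}" "\<forall>e\<in>E. \<exists>a b. a < b \<and> {a, b} \<subseteq> {1..n} \<and> e = {a, b}"
    "\<alpha> = glued_perm {1..n} \<pi> E"
proof -
  obtain P Q f where P: "partition_on {1..n} P" and Q: "partition_on {1..n} Q"
    and f: "bij_betw f P Q" and \<alpha>: "\<alpha> = {(X, f X) | X. X \<in> P}"
    and card: "\<forall>X\<in>P. card X = card (f X)"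
    using assms
    by (auto simp: factorizable_dual_monoid_def dual_sym_inv_monoid_def block_bijections_def)
  have "\<exists>g. bij_betw g X (f X)" if "X \<in> P" for X
  proof (rule finite_same_card_bij)
    have "X \<subseteq> {1..n}" using P that by (auto simp: partition_on_def)
    then show "finite X" by (rule finite_subset) simp
    have "f X \<in> Q" using f that by (auto simp: bij_betw_def)
    then have "f X \<subseteq> {1..n}" using Q by (auto simp: partition_on_def)
    then show "finite (f X)" by (rule finite_subset) simp
  qed (use card that in auto)
  then obtain g where g: "\<And>X. X \<in> P \<Longrightarrow> bij_betw (g X) X (f X)"
    by metis
  \<comment> \<open>Patch the bijections \<open>g X\<close> together to a single permutation.\<close>
  define block_of where "block_of x = (THE X. X \<in> P \<and> x \<in> X)" for x
  have block_of: "block_of x = X" if "X \<in> P" "x \<in> X" for x X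
    unfolding block_of_def
    by (rule the_equality) (use that P in \<open>auto simp: partition_on_def disjoint_def\<close>)
  define \<pi> where "\<pi> x = (if x \<in> {1..n} then g (block_of x) x else x)" for x
  have \<pi>: "bij_betw \<pi> X (f X)" if "X \<in> P" for X
  proof -
    have "\<pi> x = g X x" if "x \<in> X" for x
      using \<open>X \<in> P\<close> that block_of P by (auto simp: \<pi>_def partition_on_def)
    then show ?thesis using g[OF that] by (simp cong: bij_betw_cong)
  qed
  have "disjoint_family_on f P"
    unfolding disjoint_family_on_def
  proof (intro ballI impI)
    fix X Y assume "X \<in> P" "Y \<in> P" "X \<noteq> Y"
    then have "f X \<in> Q" "f Y \<in> Q" "f X \<noteq> f Y"
      using f by (auto simp: bij_betw_def inj_on_eq_iff)
    then show "f X \<inter> f Y = {}"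
      using Q by (auto simp: partition_on_def disjoint_def)
  qed
  then have "bij_betw \<pi> (\<Union>X\<in>P. X) (\<Union>X\<in>P. f X)"
    by (rule bij_betw_UNION_disjoint) (rule \<pi>)
  moreover have "(\<Union>X\<in>P. X) = {1..n}" "(\<Union>X\<in>P. f X) = {1..n}"
    using P Q f by (auto simp: partition_on_def bij_betw_def)
  ultimately have perm: "\<pi> permutes {1..n}"
    by (intro bij_imp_permutes) (auto simp: \<pi>_def)
  define E where "E = {{x, y} | x y. x \<noteq> y \<and> (\<exists>X\<in>P. x \<in> X \<and> y \<in> X)}"
  have "blocks {1..n} E = P"
    unfolding E_def by (rule blocks_partition[OF P])
  moreover have "\<pi> ` X = f X" if "X \<in> P" for X
    using \<pi>[OF that] by (rule bij_betw_imp_surj_on)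
  ultimately have eq: "\<alpha> = glued_perm {1..n} \<pi> E"
    by (auto simp: \<alpha> glued_perm_def)
  have "\<exists>a b. a < b \<and> {a, b} \<subseteq> {1..n} \<and> e = {a, b}"
    if e: "e \<in> E" for e
  proof -
    obtain x y X where "e = {x, y}" "x \<noteq> y" "X \<in> P" "x \<in> X" "y \<in> X"
      using e unfolding E_def by blast
    moreover from this have "{x, y} \<subseteq> {1..n}"
      using P unfolding partition_on_def by blast
    ultimately show ?thesis
      by (intro exI[of _ "min x y"] exI[of _ "max x y"]) (auto simp: min_def max_def)
  qed
  then have "\<forall>e\<in>E. \<exists>a b. a < b \<and> {a, b} \<subseteq> {1..n} \<and> e = {a, b}"
    by blast
  with perm show ?thesis
    using eq by (rule that)
qed


section \<open>Evaluation of singular braid words\<close>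

fun word_perm :: "sb_gen list \<Rightarrow> nat \<Rightarrow> nat" where
  "word_perm [] = id"
| "word_perm (Sigma i # w) = transpose i (i + 1) \<circ> word_perm w"
| "word_perm (Sigma_inv i # w) = transpose i (i + 1) \<circ> word_perm w"
| "word_perm (Tau i # w) = word_perm w"

text \<open>Products are read with the right-hand factor applied first, so an edge contributed by the head of
  a word is seen by the starting points through the permutation of the rest of the word.\<close>

fun word_edges :: "sb_gen list \<Rightarrow> nat set set" where
  "word_edges [] = {}"
| "word_edges (Sigma i # w) = word_edges w"
| "word_edges (Sigma_inv i # w) = word_edges w"
| "word_edges (Tau i # w) = insert (word_perm w -` {i, i + 1}) (word_edges w)"

lemma word_perm_append: "word_perm (u @ v) = word_perm u \<circ> word_perm v"
  by (induction u rule: word_perm.induct) (simp_all add: o_assoc)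

lemma word_edges_append: "word_edges (u @ v) = word_edges v \<union> (-`) (word_perm v) ` word_edges u"
  by (induction u rule: word_edges.induct) (auto simp: word_perm_append vimage_comp)

lemma word_perm_permutes: "w \<in> lists (sb_gens n) \<Longrightarrow> word_perm w permutes {1..n}"
  by (induction w rule: word_perm.induct)
    (auto simp: sb_gens_def intro!: permutes_id permutes_compose permutes_swap_id)

lemma word_edges_subset: "w \<in> lists (sb_gens n) \<Longrightarrow> word_edges w \<subseteq> Pow {1..n}"
proof (induction w rule: word_edges.induct)
  case (4 i w)
  then have "w \<in> lists (sb_gens n)" "{i, i + 1} \<subseteq> {1..n}"
    by (auto simp: sb_gens_def)
  then have "word_perm w permutes {1..n}" "{i, i + 1} \<subseteq> {1..n}"
    by (simp_all only: word_perm_permutes)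
  then have "word_perm w -` {i, i + 1} \<subseteq> {1..n}"
    using permutes_vimage vimage_mono by blast
  then show ?case using 4 by auto
qed auto

text \<open>In the mixed braid relation both sides have the edge \<open>{j, j + 1}\<close>, since \<open>s\<^sub>j s\<^sub>i\<close> carries
  \<open>{j, j + 1}\<close> onto \<open>{i, i + 1}\<close> for neighbouring \<open>i\<close> and \<open>j\<close>.\<close>

lemma word_perm_edges_sb_rels:
  assumes "(u, v) \<in> sb_rels n"
  shows "word_perm u = word_perm v \<and> word_edges u = word_edges v"
  using assms
proof cases
  case (braid i j)
  then have "j = i + 1 \<or> i = j + 1" by auto
  then show ?thesis using braid by (auto simp: fun_eq_iff transpose_def)
next
  case (tau_braid i j)
  then have "j = i + 1 \<or> i = j + 1" by auto
  then show ?thesis using tau_braid by (auto simp: fun_eq_iff transpose_def split: if_splits)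
qed (auto simp: fun_eq_iff transpose_def split: if_splits)

lemma word_perm_edges_cong:
  assumes "(u, v) \<in> presentation_cong A (sb_rels n)"
  shows "word_perm u = word_perm v \<and> word_edges u = word_edges v"
  using assms
  by induction (auto simp: word_perm_append word_edges_append dest: word_perm_edges_sb_rels)

definition word_value :: "nat \<Rightarrow> sb_gen list \<Rightarrow> (nat set \<times> nat set) set" where
  "word_value n w = glued_perm {1..n} (word_perm w) (word_edges w)"

lemma word_value_append:
  assumes "u \<in> lists (sb_gens n)" "v \<in> lists (sb_gens n)"
  shows "word_value n (u @ v) = block_mult n (word_value n u) (word_value n v)"
  unfolding word_value_def word_perm_append word_edges_append
  using assms by (intro block_mult_glued_perm[symmetric] word_perm_permutes word_edges_subset)

lemma blocks_empty: "blocks A {} = {{x} | x. x \<in> A}"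
  by (auto simp: blocks_def glue_rel_def quotient_def)

lemma glued_perm_empty: "glued_perm {1..n} \<pi> {} = perm_element n \<pi>"
  by (auto simp: glued_perm_def perm_element_def blocks_empty)

lemma word_value_Nil: "word_value n [] = perm_element n id"
  and word_value_Sigma: "word_value n [Sigma i] = simple_transposition n i"
  and word_value_Sigma_inv: "word_value n [Sigma_inv i] = simple_transposition n i"
  by (simp_all only: word_value_def simple_transposition_def word_perm.simps word_edges.simps
      glued_perm_empty comp_id)

lemma word_value_Tau:
  assumes "i \<in> {1..<n}"
  shows "word_value n [Tau i] = xi n i"
proof -
  let ?P = "insert {i, i + 1} {{x} | x. x \<in> {1..n} - {i, i + 1}}"
  have "\<Union>{{x} | x. x \<in> S} = S" for S :: "nat set"
    by auto
  then have "partition_on {1..n} ?P"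
    using assms by (auto simp only: partition_on_def disjoint_def Union_insert) auto
  moreover have "{{x, y} | x y. x \<noteq> y \<and> (\<exists>X\<in>?P. x \<in> X \<and> y \<in> X)} = {{i, i + 1}}" (is "?L = _")
  proof
    show "?L \<subseteq> {{i, i + 1}}"
    proof
      fix e assume "e \<in> ?L"
      then obtain x y X where "e = {x, y}" "x \<noteq> y" "X \<in> ?P" "x \<in> X" "y \<in> X"
        by blast
      then show "e \<in> {{i, i + 1}}"
        by (elim insertE) auto
    qed
    have "{i, i + 1} \<in> ?L"
      by (intro CollectI exI[of _ i] exI[of _ "i + 1"] conjI bexI[of _ "{i, i + 1}"]) simp_all
    then show "{{i, i + 1}} \<subseteq> ?L"
      by simp
  qed
  ultimately have "blocks {1..n} {{i, i + 1}} = ?P"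
    using blocks_partition[of "{1..n}" ?P] by simp
  then show ?thesis
    by (auto simp: word_value_def glued_perm_def xi_def)
qed

lemma word_with_perm:
  assumes "\<pi> permutes {1..n}"
  shows "\<exists>w\<in>lists (sb_gens n). word_perm w = \<pi> \<and> word_edges w = {}"
  using assms finite_atLeastAtMost
proof (induction rule: permutes_induct)
  case id
  then show ?case by (intro bexI[of _ "[]"]) auto
next
  case (swap a b \<pi>)
  have Sigmas: "word_perm (map Sigma xs) = apply_adj_transps xs" "word_edges (map Sigma xs) = {}" for xs
    by (induction xs) simp_all
  have Sigmas_gens: "map Sigma xs \<in> lists (sb_gens n)" if "set xs \<subseteq> {1..<n}" for xs
    using that by (induction xs) (auto simp: sb_gens_def)
  have "\<exists>xs. set xs \<subseteq> {1..<n} \<and> apply_adj_transps xs = transpose a b"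
  proof (cases "a < b")
    case True
    then show ?thesis using swap.hyps
      by (intro exI[of _ "adj_transp_seq a b"]) (auto simp: adj_transp_seq_correct set_adj_transp_seq)
  next
    case False
    then have "b < a" using swap.hyps by simp
    then show ?thesis using swap.hyps
      by (intro exI[of _ "adj_transp_seq b a"])
        (auto simp: adj_transp_seq_correct set_adj_transp_seq transpose_commute)
  qed
  then obtain xs where xs: "set xs \<subseteq> {1..<n}" "apply_adj_transps xs = transpose a b"
    by blast
  obtain w where "w \<in> lists (sb_gens n)" "word_perm w = \<pi>" "word_edges w = {}"
    using swap.IH by blast
  then show ?case using xs(2) Sigmas_gens[OF xs(1)]
    by (intro bexI[of _ "map Sigma xs @ w"]) (simp_all add: word_perm_append word_edges_append Sigmas)
qed

text \<open>Conjugate \<open>Tau a\<close> by the transposition of \<open>a + 1\<close> and \<open>b\<close>, which fixes \<open>a\<close> and is the identity if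
  \<open>b = a + 1\<close>.\<close>

lemma word_with_edge:
  assumes "a < b" "{a, b} \<subseteq> {1..n}"
  shows "\<exists>w\<in>lists (sb_gens n). word_perm w = id \<and> word_edges w = {{a, b}}"
proof -
  let ?t = "transpose (a + 1) b"
  have "?t permutes {1..n}"
    using assms by (intro permutes_swap_id) auto
  then obtain v where v: "v \<in> lists (sb_gens n)" "word_perm v = ?t" "word_edges v = {}"
    using word_with_perm by blast
  have "?t -` {a, a + 1} = {a, b}"
    using assms by (auto simp: transpose_def split: if_splits)
  then show ?thesis
    using v assms
    by (intro bexI[of _ "v @ [Tau a] @ v"])
      (auto simp: word_perm_append word_edges_append sb_gens_def)
qed

text \<open>A word for the permutation, followed on the right by words that evaluate to the identity
  permutation with one edge each: such a factor adds its edge and leaves everything else alone.\<close>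

lemma word_with_perm_edges:
  assumes \<pi>: "\<pi> permutes {1..n}"
    and E: "\<forall>e\<in>E. \<exists>a b. a < b \<and> {a, b} \<subseteq> {1..n} \<and> e = {a, b}"
  shows "\<exists>w\<in>lists (sb_gens n). word_perm w = \<pi> \<and> word_edges w = E"
proof -
  have "E \<subseteq> Pow {1..n}" using E by blast
  then have "finite E" by (rule finite_subset) simp
  then show ?thesis
    using E
  proof induction
    case empty
    then show ?case using word_with_perm[OF \<pi>] by simp
  next
    case (insert e E)
    then obtain u where u: "u \<in> lists (sb_gens n)" "word_perm u = \<pi>" "word_edges u = E"
      by (meson insertCI)
    have "\<exists>a b. a < b \<and> {a, b} \<subseteq> {1..n} \<and> e = {a, b}"
      using insert.prems by (rule bspec) (rule insertI1)
    then obtain a b where ab: "a < b" "{a, b} \<subseteq> {1..n}" "e = {a, b}"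
      by (elim exE conjE)
    obtain v where v: "v \<in> lists (sb_gens n)" "word_perm v = id" "word_edges v = {e}"
      using word_with_edge[OF ab(1,2)] ab(3) by blast
    have "(-`) id ` E = E" by (simp add: image_def)
    then show ?case using u v
      by (intro bexI[of _ "u @ v"]) (auto simp: word_perm_append word_edges_append)
  qed
qed

lemma word_value_surj: "word_value n ` lists (sb_gens n) = carrier (factorizable_dual_monoid n)"
proof (intro equalityI subsetI)
  fix \<alpha> assume "\<alpha> \<in> word_value n ` lists (sb_gens n)"
  then show "\<alpha> \<in> carrier (factorizable_dual_monoid n)"
    unfolding word_value_def using glued_perm_in_factorizable word_perm_permutes by blast
next
  fix \<alpha> assume "\<alpha> \<in> carrier (factorizable_dual_monoid n)"
  then obtain \<pi> E where "\<pi> permutes {1..n}"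
      "\<forall>e\<in>E. \<exists>a b. a < b \<and> {a, b} \<subseteq> {1..n} \<and> e = {a, b}"
      "\<alpha> = glued_perm {1..n} \<pi> E"
    using factorizable_eq_glued_perm by metis
  moreover from this(1,2) obtain w where "w \<in> lists (sb_gens n)" "word_perm w = \<pi>" "word_edges w = E"
    using word_with_perm_edges by blast
  ultimately show "\<alpha> \<in> word_value n ` lists (sb_gens n)"
    by (auto simp: word_value_def)
qed


section \<open>Presented monoids\<close>

lemma presentation_cong_in_lists:
  assumes "(u, v) \<in> presentation_cong A R"
  shows "u \<in> lists A \<and> v \<in> lists A"
  using assms by induction auto

lemma equiv_presentation_cong: "equiv (lists A) (presentation_cong A R)"
  by (rule equivI)
    (auto simp: refl_on_def sym_def trans_def dest: presentation_cong_in_lists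
      intro: presentation_cong.intros)

lemma presentation_cong_append:
  assumes "(u, u') \<in> presentation_cong A R" "p \<in> lists A" "q \<in> lists A"
  shows "(p @ u @ q, p @ u' @ q) \<in> presentation_cong A R"
  using assms(1)
proof induction
  case (rel u v p' q')
  then show ?case
    using assms(2,3) presentation_cong.rel[of u v R A "p @ p'" "q' @ q"] by simp
next
  case (refl u)
  then show ?case using assms(2,3) by (intro presentation_cong.refl) simp
qed (blast intro: presentation_cong.sym presentation_cong.trans)+

lemma presentation_cong_mult:
  assumes "(u, u') \<in> presentation_cong A R" "(v, v') \<in> presentation_cong A R"
  shows "(u @ v, u' @ v') \<in> presentation_cong A R"
proof (rule presentation_cong.trans)
  show "(u @ v, u' @ v) \<in> presentation_cong A R"
    using presentation_cong_append[OF assms(1), of "[]" v] presentation_cong_in_lists[OF assms(2)] by simp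
  show "(u' @ v, u' @ v') \<in> presentation_cong A R"
    using presentation_cong_append[OF assms(2), of u' "[]"] presentation_cong_in_lists[OF assms(1)] by simp
qed

definition word_class :: "'a set \<Rightarrow> ('a list \<times> 'a list) set \<Rightarrow> 'a list \<Rightarrow> 'a list set" where
  "word_class A R w = presentation_cong A R `` {w}"

lemma word_class_eq: "(u, v) \<in> presentation_cong A R \<Longrightarrow> word_class A R u = word_class A R v"
  unfolding word_class_def by (rule equiv_class_eq[OF equiv_presentation_cong])

lemma carrier_presented_monoid: "carrier (presented_monoid A R) = word_class A R ` lists A"
  by (auto simp: presented_monoid_def quotient_def word_class_def)

lemma one_presented_monoid: "\<one>\<^bsub>presented_monoid A R\<^esub> = word_class A R []"
  by (simp add: presented_monoid_def word_class_def)

lemma mult_presented_monoid: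
  assumes "u \<in> lists A" "v \<in> lists A"
  shows "word_class A R u \<otimes>\<^bsub>presented_monoid A R\<^esub> word_class A R v = word_class A R (u @ v)"
proof -
  have "presentation_cong A R `` {u' @ v'} = word_class A R (u @ v)"
    if "u' \<in> word_class A R u" "v' \<in> word_class A R v" for u' v'
    using that word_class_eq[OF presentation_cong_mult, of u u' A R v v'] by (simp add: word_class_def)
  moreover have "u \<in> word_class A R u" "v \<in> word_class A R v"
    using assms by (auto simp: word_class_def intro: presentation_cong.refl)
  ultimately show ?thesis
    by (auto simp: presented_monoid_def)
qed


section \<open>The homomorphism\<close>

abbreviation braid_class :: "nat \<Rightarrow> sb_gen list \<Rightarrow> sb_gen list set" where
  "braid_class n \<equiv> word_class (sb_gens n) (sb_rels n)"

lemma SB_simps: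
  "carrier (SB n) = braid_class n ` lists (sb_gens n)"
  "\<one>\<^bsub>SB n\<^esub> = braid_class n []"
  "u \<in> lists (sb_gens n) \<Longrightarrow> v \<in> lists (sb_gens n) \<Longrightarrow>
    braid_class n u \<otimes>\<^bsub>SB n\<^esub> braid_class n v = braid_class n (u @ v)"
  by (simp_all add: SB_def carrier_presented_monoid one_presented_monoid mult_presented_monoid)

lemma factorizable_dual_monoid_simps:
  "\<one>\<^bsub>factorizable_dual_monoid n\<^esub> = perm_element n id"
  "\<alpha> \<otimes>\<^bsub>factorizable_dual_monoid n\<^esub> \<beta> = block_mult n \<alpha> \<beta>"
  by (simp_all add: factorizable_dual_monoid_def dual_sym_inv_monoid_def)

text \<open>All representatives of a class have the same value; the union of these values is how a
  map on classes is obtained from \<open>word_value\<close> without choosing representatives.\<close>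

lemma word_value_well_defined:
  assumes "w \<in> lists (sb_gens n)"
  shows "(\<Union>v\<in>braid_class n w. word_value n v) = word_value n w"
proof (rule UN_constant_eq)
  show "w \<in> braid_class n w"
    using assms by (auto simp: word_class_def intro: presentation_cong.refl)
  show "\<forall>v\<in>braid_class n w. word_value n v = word_value n w"
    by (auto simp: word_class_def word_value_def dest!: word_perm_edges_cong)
qed

text \<open>Cancel the involution \<open>s\<^sub>i\<close> on the right. Associativity is inherited from concatenation, as \<open>\<alpha>\<close> is the
  value of some word.\<close>

lemma Sigma_inv_determined:
  assumes i: "i \<in> {1..<n}" and \<alpha>: "\<alpha> \<in> carrier (factorizable_dual_monoid n)"
    and "block_mult n \<alpha> (simple_transposition n i) = perm_element n id"
  shows "\<alpha> = simple_transposition n i"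
proof -
  obtain w where w: "w \<in> lists (sb_gens n)" "\<alpha> = word_value n w"
    using \<alpha> word_value_surj by blast
  have s: "[Sigma i] \<in> lists (sb_gens n)"
    using i by (simp add: sb_gens_def)
  have "word_value n (w @ [Sigma i] @ [Sigma i]) = block_mult n (word_value n (w @ [Sigma i])) (word_value n [Sigma i])"
    using w s word_value_append[of "w @ [Sigma i]" n "[Sigma i]"] by simp
  also have "word_value n (w @ [Sigma i]) = word_value n []"
    using word_value_append[OF w(1) s] assms(3) w(2) by (simp only: word_value_Sigma word_value_Nil)
  also have "block_mult n (word_value n []) (word_value n [Sigma i]) = simple_transposition n i"
    using word_value_append[of "[]" n "[Sigma i]"] s by (simp add: word_value_Sigma)
  also have "word_value n (w @ [Sigma i] @ [Sigma i]) = word_value n w"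
    by (simp add: word_value_def word_perm_append word_edges_append o_def image_def)
  finally show ?thesis using w by simp
qed

text \<open>This serves both uniqueness and surjectivity of the homomorphism: its values on all words are
  forced, including those on the letters \<open>Sigma_inv i\<close>, about which nothing is prescribed.\<close>

lemma hom_eq_word_value:
  assumes h: "h \<in> monoid_hom (SB n) (factorizable_dual_monoid n)"
    and gen: "\<forall>i\<in>{1..<n}. h (sb_sigma n i) = simple_transposition n i \<and> h (sb_tau n i) = xi n i"
    and "w \<in> lists (sb_gens n)"
  shows "h (braid_class n w) = word_value n w"
proof -
  have h_Nil: "h (braid_class n []) = perm_element n id"
    using h by (simp add: monoid_hom_def SB_simps factorizable_dual_monoid_simps)
  have h_append: "h (braid_class n (u @ v)) = block_mult n (h (braid_class n u)) (h (braid_class n v))"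
    if "u \<in> lists (sb_gens n)" "v \<in> lists (sb_gens n)" for u v
    using h that hom_mult[of h "SB n" "factorizable_dual_monoid n" "braid_class n u" "braid_class n v"]
    by (simp add: monoid_hom_def SB_simps factorizable_dual_monoid_simps)
  have h_Sigma_inv: "h (braid_class n [Sigma_inv i]) = simple_transposition n i" if i: "i \<in> {1..<n}" for i
  proof (rule Sigma_inv_determined[OF i])
    have gens: "[Sigma_inv i] \<in> lists (sb_gens n)" "[Sigma i] \<in> lists (sb_gens n)"
      using i by (auto simp: sb_gens_def)
    then show "h (braid_class n [Sigma_inv i]) \<in> carrier (factorizable_dual_monoid n)"
      using h by (auto simp: monoid_hom_def hom_def SB_simps)
    have "([] @ [Sigma_inv i, Sigma i] @ [], [] @ [] @ []) \<in> presentation_cong (sb_gens n) (sb_rels n)"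
      using i gens by (intro presentation_cong.rel sb_rels.inv_left) auto
    then have "braid_class n ([Sigma_inv i] @ [Sigma i]) = braid_class n []"
      by (intro word_class_eq) simp
    then show "block_mult n (h (braid_class n [Sigma_inv i])) (simple_transposition n i) = perm_element n id"
      using h_append[OF gens] h_Nil gen i by (simp add: word_class_def sb_sigma_def)
  qed
  have h_gen: "h (braid_class n [g]) = word_value n [g]" if "g \<in> sb_gens n" for g
    using that gen h_Sigma_inv
    by (auto simp: sb_gens_def word_value_Sigma word_value_Sigma_inv word_value_Tau
        word_class_def sb_sigma_def sb_tau_def)
  show ?thesis
    using \<open>w \<in> lists (sb_gens n)\<close>
  proof (induction w)
    case Nil
    then show ?case by (simp add: h_Nil word_value_Nil)
  next
    case (Cons g w)
    then have "[g] \<in> lists (sb_gens n)" by simp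
    then show ?case
      using h_append[of "[g]" w] word_value_append[of "[g]" n w] h_gen[of g] Cons by simp
  qed
qed

theorem proposition10:
  fixes n :: nat
  shows "(\<exists>!h. h \<in> monoid_hom (SB n) (factorizable_dual_monoid n) \<inter> extensional (carrier (SB n)) \<and>
            (\<forall>i\<in>{1..<n}. h (sb_sigma n i) = simple_transposition n i \<and> h (sb_tau n i) = xi n i)) \<and>
         (\<forall>h. h \<in> monoid_hom (SB n) (factorizable_dual_monoid n) \<and>
            (\<forall>i\<in>{1..<n}. h (sb_sigma n i) = simple_transposition n i \<and> h (sb_tau n i) = xi n i) \<longrightarrow>
            h ` carrier (SB n) = carrier (factorizable_dual_monoid n))"
proof (intro conjI allI impI ex_ex1I)
  define h where "h = restrict (\<lambda>X. \<Union>w\<in>X. word_value n w) (carrier (SB n))"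
  have h: "h (braid_class n w) = word_value n w" if "w \<in> lists (sb_gens n)" for w
    using that by (simp add: h_def SB_simps word_value_well_defined)
  have "word_value n w \<in> carrier (factorizable_dual_monoid n)" if "w \<in> lists (sb_gens n)" for w
    using that word_value_surj by blast
  then have "h \<in> carrier (SB n) \<rightarrow> carrier (factorizable_dual_monoid n)"
    unfolding SB_simps using h by fastforce
  then have "h \<in> monoid_hom (SB n) (factorizable_dual_monoid n)"
    by (auto simp: monoid_hom_def hom_def SB_simps factorizable_dual_monoid_simps h
        word_value_Nil word_value_append)
  moreover have "h \<in> extensional (carrier (SB n))"
    by (simp add: h_def)
  moreover have "h (sb_sigma n i) = simple_transposition n i \<and> h (sb_tau n i) = xi n i"
    if "i \<in> {1..<n}" for i
    using that h[of "[Sigma i]"] h[of "[Tau i]"]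
    by (simp add: sb_gens_def word_value_Sigma word_value_Tau word_class_def sb_sigma_def sb_tau_def)
  ultimately show "\<exists>h. h \<in> monoid_hom (SB n) (factorizable_dual_monoid n) \<inter> extensional (carrier (SB n)) \<and>
      (\<forall>i\<in>{1..<n}. h (sb_sigma n i) = simple_transposition n i \<and> h (sb_tau n i) = xi n i)"
    by blast
next
  fix h h'
  assume h: "h \<in> monoid_hom (SB n) (factorizable_dual_monoid n) \<inter> extensional (carrier (SB n)) \<and>
      (\<forall>i\<in>{1..<n}. h (sb_sigma n i) = simple_transposition n i \<and> h (sb_tau n i) = xi n i)"
    and h': "h' \<in> monoid_hom (SB n) (factorizable_dual_monoid n) \<inter> extensional (carrier (SB n)) \<and>
      (\<forall>i\<in>{1..<n}. h' (sb_sigma n i) = simple_transposition n i \<and> h' (sb_tau n i) = xi n i)"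
  have "h X = h' X" if X: "X \<in> carrier (SB n)" for X
  proof -
    obtain w where w: "w \<in> lists (sb_gens n)" "X = braid_class n w"
      using X unfolding SB_simps by blast
    have "h (braid_class n w) = word_value n w"
      by (rule hom_eq_word_value[of h n w, OF IntD1[OF conjunct1[OF h]] conjunct2[OF h] w(1)])
    moreover have "h' (braid_class n w) = word_value n w"
      by (rule hom_eq_word_value[of h' n w, OF IntD1[OF conjunct1[OF h']] conjunct2[OF h'] w(1)])
    ultimately show ?thesis
      by (simp only: w(2))
  qed
  moreover have "h \<in> extensional (carrier (SB n))" "h' \<in> extensional (carrier (SB n))"
    using h h' by simp_all
  ultimately show "h = h'"
    by (intro extensionalityI[of h "carrier (SB n)" h'])
next
  fix h
  assume h: "h \<in> monoid_hom (SB n) (factorizable_dual_monoid n) \<and>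
      (\<forall>i\<in>{1..<n}. h (sb_sigma n i) = simple_transposition n i \<and> h (sb_tau n i) = xi n i)"
  have word: "h (braid_class n w) = word_value n w" if "w \<in> lists (sb_gens n)" for w
    by (rule hom_eq_word_value[of h n w, OF conjunct1[OF h] conjunct2[OF h] that])
  have "h ` carrier (SB n) = word_value n ` lists (sb_gens n)"
    unfolding SB_simps image_image by (rule image_cong[OF HOL.refl word])
  then show "h ` carrier (SB n) = carrier (factorizable_dual_monoid n)"
    by (simp add: word_value_surj)
qed

end
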